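(* Let $$P = \begin{pmatrix} 1 & 1/2 & 1/2 \\ 1/2 & 1/2 & 1/2 \\ 1/2 & 1/2 & 0 \end{pmatrix},\qquad L = \begin{pmatrix} 1 & 1/2 & 1/2 \\ 1/2 & 1/3 & 1/3 \\ 2/3 & 1/2 & 1/6 \end{pmatrix}$$ be tables of probabilities in Collins–Gisin notation, and for $\mu\in\mathbb{R}$ let $l_1(\mu) = \mu P + (1-\mu)L$. Then the maximum of $\mu$ over all $\mu\in\mathbb{R}$ such that $l_1(\mu)$ belongs to the Almost Quantum set exists and is equal to $0$. (That is, $l_1(0)$ belongs to the Almost Quantum set, and every real $\mu$ for which $l_1(\mu)$ belongs to the Almost Quantum set satisfies $\mu\le 0$.)
   Context: Bipartite scenario with two settings and two outcomes per party. A table in Collins–Gisin notation is a real $3\times 3$ matrix $$\begin{pmatrix} 1 & p_B(0) & p_B(1) \\ p_A(0) & p(0,0) & p(0,1) \\ p_A(1) & p(1,0) & p(1,1) \end{pmatrix},$$ where $p_A(x)$ (resp. $p_B(y)$) is the probability that Alice (resp. Bob) obtains the first outcome for setting $x$ (resp. $y$), and $p(x,y)$ is the probability that both obtain the first outcome for settings $x,y\in\{0,1\}$. Almost Quantum set: a table in Collins–Gisin notation with entries $p_A(x), p_B(y), p(x,y)$, $x,y\in\{0,1\}$, belongs to the Almost Quantum set if and only if there exist real numbers $a_{01}, b_{01}, c_{0,01}, c_{1,01}, c_{01,0}, c_{01,1}, c_{01,01}, c_{01,10}$ such that the following real symmetric $9\times 9$ matrix (only the upper triangle is displayed; the lower triangle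 is determined by symmetry) is positive semidefinite. Rows and columns are indexed, in order, by the words $1, A_0, A_1, B_0, B_1, A_0B_0, A_0B_1, A_1B_0, A_1B_1$: $$\begin{pmatrix} 1 & p_A(0) & p_A(1) & p_B(0) & p_B(1) & p(0,0) & p(0,1) & p(1,0) & p(1,1) \\ & p_A(0) & a_{01} & p(0,0) & p(0,1) & p(0,0) & p(0,1) & c_{01,0} & c_{01,1} \\ & & p_A(1) & p(1,0) & p(1,1) & c_{01,0} & c_{01,1} & p(1,0) & p(1,1) \\ & & & p_B(0) & b_{01} & p(0,0) & c_{0,01} & p(1,0) & c_{1,01} \\ & & & & p_B(1) & c_{0,01} & p(0,1) & c_{1,01} & p(1,1) \\ & & & & & p(0,0) & c_{0,01} & c_{01,0} & c_{01,01} \\ & & & & & & p(0,1) & c_{01,10} & c_{01,1} \\ & & & & & & & p(1,0) & c_{1,01} \\ & & & & & & & & p(1,1) \end{pmatrix} \ge 0.$$ *)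

theory Defs
  imports Complex_Main "Jordan_Normal_Form.Matrix"
begin

definition pos_semidef :: "real mat \<Rightarrow> bool" where
  "pos_semidef M \<longleftrightarrow>
     square_mat M \<and> transpose_mat M = M \<and>
     (\<forall>v \<in> carrier_vec (dim_row M). 0 \<le> v \<bullet> (M *\<^sub>v v))"

text \<open>The symmetric matrix whose upper triangle is given row by row, each row
  starting at its diagonal entry.\<close>

definition sym_of_upper :: "'a list list \<Rightarrow> 'a mat" where
  "sym_of_upper rs = mat (length rs) (length rs)
     (\<lambda>(i, j). if i \<le> j then rs ! i ! (j - i) else rs ! j ! (i - j))"

text \<open>Tables in Collins--Gisin notation have \<open>1\<close> in the corner, Bob's marginals in the rest
  of the first row and Alice's marginals in the rest of the first column. Only this shape is
  required, not non-negativity of the probabilities. Settings are \<open>0\<close> and \<open>1\<close>.\<close>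

definition cg_table :: "real mat \<Rightarrow> bool" where
  "cg_table T \<longleftrightarrow> T \<in> carrier_mat 3 3 \<and> T $$ (0, 0) = 1"

definition pA :: "real mat \<Rightarrow> nat \<Rightarrow> real" where
  "pA T x = T $$ (x + 1, 0)"

definition pB :: "real mat \<Rightarrow> nat \<Rightarrow> real" where
  "pB T y = T $$ (0, y + 1)"

definition pAB :: "real mat \<Rightarrow> nat \<Rightarrow> nat \<Rightarrow> real" where
  "pAB T x y = T $$ (x + 1, y + 1)"

text \<open>Rows and columns are indexed, in order, by the words
  \<open>1, A0, A1, B0, B1, A0 B0, A0 B1, A1 B0, A1 B1\<close>.\<close>

definition aq_matrix ::
  "real mat \<Rightarrow> real \<Rightarrow> real \<Rightarrow> real \<Rightarrow> real \<Rightarrow> real \<Rightarrow> real \<Rightarrow> real \<Rightarrow> real \<Rightarrow> real mat" where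
  "aq_matrix T a01 b01 c0_01 c1_01 c01_0 c01_1 c01_01 c01_10 = sym_of_upper
     [[1, pA T 0, pA T 1, pB T 0, pB T 1, pAB T 0 0, pAB T 0 1, pAB T 1 0, pAB T 1 1],
      [pA T 0, a01, pAB T 0 0, pAB T 0 1, pAB T 0 0, pAB T 0 1, c01_0, c01_1],
      [pA T 1, pAB T 1 0, pAB T 1 1, c01_0, c01_1, pAB T 1 0, pAB T 1 1],
      [pB T 0, b01, pAB T 0 0, c0_01, pAB T 1 0, c1_01],
      [pB T 1, c0_01, pAB T 0 1, c1_01, pAB T 1 1],
      [pAB T 0 0, c0_01, c01_0, c01_01],
      [pAB T 0 1, c01_10, c01_1],
      [pAB T 1 0, c1_01],
      [pAB T 1 1]]"

definition almost_quantum :: "real mat set" where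
  "almost_quantum = {T. cg_table T \<and>
     (\<exists>a01 b01 c0_01 c1_01 c01_0 c01_1 c01_01 c01_10.
        pos_semidef (aq_matrix T a01 b01 c0_01 c1_01 c01_0 c01_1 c01_01 c01_10))}"

definition table_P :: "real mat" where
  "table_P = mat_of_rows_list 3
     [[1,   1/2, 1/2],
      [1/2, 1/2, 1/2],
      [1/2, 1/2, 0]]"

definition table_L :: "real mat" where
  "table_L = mat_of_rows_list 3
     [[1,   1/2, 1/2],
      [1/2, 1/3, 1/3],
      [2/3, 1/2, 1/6]]"

definition l1 :: "real \<Rightarrow> real mat" where
  "l1 \<mu> = \<mu> \<cdot>\<^sub>m table_P + (1 - \<mu>) \<cdot>\<^sub>m table_L"

end

(* At L, the uniform mixture of six deterministic strategies, the table is local, hence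
   Almost Quantum. For the upper bound, read the moment matrix as the Gram matrix of vectors
   indexed by the words. Along l1 the probabilities P(not A1, B0) and P(not A1, not B1)
   vanish, so the vectors B0 - A1B0 and B1 - A1B1 - 1 + A1 are null. Their vanishing inner
   products with A0B0 fix two of the free entries, and the squared norm of
   A0B1 - (A0 - A0B0) - A1B1 (the CHSH combination) then becomes -mu/2. *)

theory Submission
  imports Defs
begin

text \<open>With \<open>w = M u\<close> and \<open>u\<close> isotropic, the quadratic form at
  \<open>w + t u\<close> is affine in \<open>t\<close>, with slope twice the squared norm of
  \<open>w\<close>. Being nonnegative for all real \<open>t\<close> forces that slope to
  vanish.\<close>

lemma pos_semidef_null:
  assumes M: "pos_semidef M" and u: "u \<in> carrier_vec (dim_row M)"
    and q: "u \<bullet> (M *\<^sub>v u) = 0"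
  shows "M *\<^sub>v u = 0\<^sub>v (dim_row M)"
proof -
  let ?n = "dim_row M"
  let ?w = "M *\<^sub>v u"
  have Mc: "M \<in> carrier_mat ?n ?n" and sym: "transpose_mat M = M"
    using M by (auto simp: pos_semidef_def)
  have wc: "?w \<in> carrier_vec ?n"
    using Mc u by (rule mult_mat_vec_carrier)
  define a where "a = ?w \<bullet> (M *\<^sub>v ?w)"
  define k where "k = ?w \<bullet> ?w"
  have adj: "u \<bullet> (M *\<^sub>v ?w) = k"
    using transpose_vec_mult_scalar[OF Mc wc u] sym by (simp add: k_def)
  have lin: "0 \<le> a + 2 * t * k" for t
  proof -
    have tu: "t \<cdot>\<^sub>v u \<in> carrier_vec ?n"
      using u by simp
    have Mwc: "M *\<^sub>v ?w \<in> carrier_vec ?n"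
      using Mc wc by (rule mult_mat_vec_carrier)
    have "0 \<le> (?w + t \<cdot>\<^sub>v u) \<bullet> (M *\<^sub>v (?w + t \<cdot>\<^sub>v u))"
      using M wc tu unfolding pos_semidef_def by (meson add_carrier_vec)
    also have "M *\<^sub>v (?w + t \<cdot>\<^sub>v u) = M *\<^sub>v ?w + t \<cdot>\<^sub>v ?w"
      using mult_add_distrib_mat_vec[OF Mc wc tu] mult_mat_vec[OF Mc u] by simp
    also have "(?w + t \<cdot>\<^sub>v u) \<bullet> \<dots> = a + 2 * t * k"
      using u wc Mwc tu q adj
      by (simp add: add_scalar_prod_distrib[of _ ?n] scalar_prod_add_distrib[of _ ?n] a_def k_def)
    finally show ?thesis .
  qed
  have "k = 0"
  proof (rule ccontr)
    assume "k \<noteq> 0"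
    then show False
      \<comment> \<open>At this \<open>t\<close> the affine function takes the value -1.\<close>
      using lin[of "- (a + 1) / (2 * k)"] by (simp add: field_simps)
  qed
  then have "?w \<bullet>c ?w = 0"
    by (simp add: k_def)
  then show ?thesis
    using conjugate_square_eq_0_vec[OF wc] by simp
qed

text \<open>The quadratic form at \<open>v\<close> is \<open>c\<close> times a sum of squares, one
  for each \<open>k\<close>: the square of the pairing of \<open>f k\<close> with
  \<open>v\<close>.\<close>

lemma pos_semidef_gram:
  assumes "0 \<le> c"
  shows "pos_semidef (mat n n (\<lambda>(i, j). c * (\<Sum>k\<in>K. f k i * f k j)))" (is "pos_semidef ?M")
proof -
  have "0 \<le> v \<bullet> (?M *\<^sub>v v)" if v: "v \<in> carrier_vec n" for v
  proof -
    have "v \<bullet> (?M *\<^sub>v v)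
        = (\<Sum>i<n. v $ i * (\<Sum>j<n. c * (\<Sum>k\<in>K. f k i * f k j) * v $ j))"
      using v by (simp add: scalar_prod_def atLeast0LessThan)
    also have "\<dots> = (\<Sum>i<n. \<Sum>j<n. \<Sum>k\<in>K. c * ((f k i * v $ i) * (f k j * v $ j)))"
      by (simp add: sum_distrib_left sum_distrib_right mult_ac)
    also have "\<dots> = (\<Sum>i<n. \<Sum>k\<in>K. \<Sum>j<n. c * ((f k i * v $ i) * (f k j * v $ j)))"
      by (intro sum.cong refl sum.swap)
    also have "\<dots> = (\<Sum>k\<in>K. \<Sum>i<n. \<Sum>j<n. c * ((f k i * v $ i) * (f k j * v $ j)))"
      by (rule sum.swap)
    also have "\<dots> = (\<Sum>k\<in>K. c * (\<Sum>i<n. f k i * v $ i)\<^sup>2)"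
      by (simp only: power2_eq_square sum_product) (simp only: sum_distrib_left)
    also have "\<dots> \<ge> 0"
      using assms by (intro sum_nonneg mult_nonneg_nonneg) auto
    finally show ?thesis .
  qed
  then show ?thesis
    by (auto simp: pos_semidef_def mult.commute)
qed

text \<open>Value 1 stands for the first outcome and 0 for the second. The order of the words is
  that of the rows of \<open>aq_matrix\<close>, so the outer product of this list with itself is the
  moment matrix of the strategy.\<close>

definition deterministic_moments :: "real \<times> real \<times> real \<times> real \<Rightarrow> real list" where
  "deterministic_moments = (\<lambda>(a0, a1, b0, b1).
     [1, a0, a1, b0, b1, a0 * b0, a0 * b1, a1 * b0, a1 * b1])"

lemma almost_quantumI:
  assumes "cg_table T"
    and "pos_semidef (aq_matrix T a01 b01 c0_01 c1_01 c01_0 c01_1 c01_01 c01_10)"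
  shows "T \<in> almost_quantum"
  unfolding almost_quantum_def using assms by blast

lemma l1_entries:
  "pA (l1 \<mu>) 0 = 1/2" "pA (l1 \<mu>) (Suc 0) = 2/3 - \<mu>/6"
  "pB (l1 \<mu>) 0 = 1/2" "pB (l1 \<mu>) (Suc 0) = 1/2"
  "pAB (l1 \<mu>) 0 0 = 1/3 + \<mu>/6" "pAB (l1 \<mu>) 0 (Suc 0) = 1/3 + \<mu>/6"
  "pAB (l1 \<mu>) (Suc 0) 0 = 1/2" "pAB (l1 \<mu>) (Suc 0) (Suc 0) = 1/6 - \<mu>/6"
  by (simp_all add: pA_def pB_def pAB_def l1_def table_P_def table_L_def mat_of_rows_list_def
      numeral_2_eq_2 numeral_3_eq_3 field_simps)

lemma cg_table_l1: "cg_table (l1 \<mu>)"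
  unfolding cg_table_def
  by (intro conjI carrier_matI) (simp_all add: l1_def table_P_def table_L_def mat_of_rows_list_def)

text \<open>Splits an equality of 9 by 9 matrices into 81 numerical identities for the
  simplifier.\<close>

lemma all_less_9: "(\<forall>i<9::nat. P i) \<longleftrightarrow>
    P 0 \<and> P 1 \<and> P 2 \<and> P 3 \<and> P 4 \<and> P 5 \<and> P 6 \<and> P 7 \<and> P 8"
  by (simp add: eval_nat_numeral All_less_Suc conj_ac)

lemma l1_0_almost_quantum: "l1 0 \<in> almost_quantum"
proof -
  define K :: "(real \<times> real \<times> real \<times> real) set" where
    "K = {(0,0,0,1), (1,0,0,1), (0,1,0,0), (0,1,1,0), (1,1,1,0), (1,1,1,1)}"
  \<comment> \<open>The free entries are averages over \<open>K\<close> of the corresponding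
    products: \<open>a0 * a1\<close> has mean 1/3, \<open>b0 * b1\<close> has mean 1/6, and
    \<open>a0 * a1 * b0\<close> has mean 1/3. The others have mean 1/6, since only the all-ones
    strategy contributes.\<close>
  let ?A = "aq_matrix (l1 0) (1/3) (1/6) (1/6) (1/6) (1/3) (1/6) (1/6) (1/6)"
  let ?G = "mat 9 9 (\<lambda>(i, j). 1/6 * (\<Sum>k\<in>K.
    deterministic_moments k ! i * deterministic_moments k ! j))"
  have "\<forall>i<9. \<forall>j<9. ?A $$ (i, j) = ?G $$ (i, j)"
    unfolding all_less_9
    by (simp add: aq_matrix_def sym_of_upper_def l1_entries K_def deterministic_moments_def)
  moreover have "dim_row ?A = 9" "dim_col ?A = 9"
    by (simp_all add: aq_matrix_def sym_of_upper_def)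
  ultimately have "?A = ?G"
    by (intro eq_matI) auto
  then have "pos_semidef ?A"
    using pos_semidef_gram[of "1/6" 9 "\<lambda>k i. deterministic_moments k ! i" K] by simp
  then show ?thesis
    by (rule almost_quantumI[OF cg_table_l1])
qed

lemma l1_almost_quantum_le_0:
  assumes "l1 \<mu> \<in> almost_quantum"
  shows "\<mu> \<le> 0"
proof -
  obtain a01 b01 c0_01 c1_01 c01_0 c01_1 c01_01 c01_10 where
    psd: "pos_semidef (aq_matrix (l1 \<mu>) a01 b01 c0_01 c1_01 c01_0 c01_1 c01_01 c01_10)"
    using assms unfolding almost_quantum_def by blast
  define M where "M = aq_matrix (l1 \<mu>) a01 b01 c0_01 c1_01 c01_0 c01_1 c01_01 c01_10"
  have psd: "pos_semidef M"
    using psd by (simp add: M_def)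
  have dim: "dim_row M = 9" "dim_col M = 9"
    by (simp_all add: M_def aq_matrix_def sym_of_upper_def)
  have range9: "{0..<9} = {0, 1, 2, 3, 4, 5, 6, 7, 8::nat}"
    by (simp add: upt_rec eval_nat_numeral flip: set_upt)
  note expand = scalar_prod_def range9 dim
  note entries = M_def aq_matrix_def sym_of_upper_def l1_entries
  define u :: "real vec" where "u = unit_vec 9 3 - unit_vec 9 7"
  define v :: "real vec" where "v = unit_vec 9 4 - unit_vec 9 8 - unit_vec 9 0 + unit_vec 9 2"
  define w :: "real vec" where "w = unit_vec 9 6 - unit_vec 9 1 + unit_vec 9 5 - unit_vec 9 8"
  have carr: "u \<in> carrier_vec 9" "v \<in> carrier_vec 9" "w \<in> carrier_vec 9"
    by (simp_all add: u_def v_def w_def)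
  \<comment> \<open>Index 5 is the word A0 B0, so this component is the inner product of the null
    vector with A0B0.\<close>
  have null: "(M *\<^sub>v x) $ 5 = 0" if "x \<in> carrier_vec 9" "x \<bullet> (M *\<^sub>v x) = 0" for x
    by (subst pos_semidef_null[OF psd]) (simp_all add: that dim)
  \<comment> \<open>This squared norm is \<open>pB 0 - pAB 1 0\<close>, the probability P(not A1,
    B0).\<close>
  have "u \<bullet> (M *\<^sub>v u) = M $$ (3, 3) - M $$ (3, 7) - M $$ (7, 3) + M $$ (7, 7)"
    by (simp add: expand u_def)
  also have "\<dots> = 0"
    by (simp add: entries)
  finally have "(M *\<^sub>v u) $ 5 = 0"
    by (rule null[OF carr(1)])
  then have "M $$ (5, 3) - M $$ (5, 7) = 0"
    by (simp add: expand u_def)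
  then have c: "c01_0 = 1/3 + \<mu>/6"
    by (simp add: entries)
  \<comment> \<open>This squared norm reduces to \<open>1 - pA 1 - pB 1 + pAB 1 1\<close>, the
    probability P(not A1, not B1); the terms in \<mu> cancel.\<close>
  have "v \<bullet> (M *\<^sub>v v) =
      M $$ (0, 0) - M $$ (0, 2) - M $$ (0, 4) + M $$ (0, 8)
    - M $$ (2, 0) + M $$ (2, 2) + M $$ (2, 4) - M $$ (2, 8)
    - M $$ (4, 0) + M $$ (4, 2) + M $$ (4, 4) - M $$ (4, 8)
    + M $$ (8, 0) - M $$ (8, 2) - M $$ (8, 4) + M $$ (8, 8)"
    by (simp add: expand v_def)
  also have "\<dots> = 0"
    by (simp add: entries)
  finally have "(M *\<^sub>v v) $ 5 = 0"
    by (rule null[OF carr(2)])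
  then have "- M $$ (5, 0) + M $$ (5, 2) + M $$ (5, 4) - M $$ (5, 8) = 0"
    by (simp add: expand v_def)
  then have c': "c0_01 = c01_01"
    using c by (simp add: entries)
  have "0 \<le> w \<bullet> (M *\<^sub>v w)"
    using psd carr dim by (simp add: pos_semidef_def)
  also have "\<dots> =
      M $$ (1, 1) - M $$ (1, 5) - M $$ (1, 6) + M $$ (1, 8)
    - M $$ (5, 1) + M $$ (5, 5) + M $$ (5, 6) - M $$ (5, 8)
    - M $$ (6, 1) + M $$ (6, 5) + M $$ (6, 6) - M $$ (6, 8)
    + M $$ (8, 1) - M $$ (8, 5) - M $$ (8, 6) + M $$ (8, 8)"
    by (simp add: expand w_def)
  \<comment> \<open>The two occurrences of \<open>c01_1\<close> with each sign cancel, and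
    \<open>c0_01 - c01_01\<close> vanishes by \<open>c'\<close>. What remains is
    \<open>pA 0 - pAB 0 0 - pAB 0 1 + pAB 1 1\<close>.\<close>
  also have "\<dots> = - \<mu> / 2"
    using c' by (simp add: entries)
  finally show ?thesis
    by simp
qed

theorem mainTheorem1:
  shows "l1 0 \<in> almost_quantum \<and> (\<forall>\<mu>::real. l1 \<mu> \<in> almost_quantum \<longrightarrow> \<mu> \<le> 0)"
  using l1_0_almost_quantum l1_almost_quantum_le_0 by blast

end
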